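(* Let $X,Y$ be complex Banach spaces and let $A\in\mathcal{L}(X,Y)$ and $B,C\in\mathcal{L}(Y,X)$ be such that $A(BA)^2=ABACA=ACABA=(AC)^2A$. Then for all nonzero $\lambda\in\mathbb{C}$, $K(AC-\lambda)$ is closed if and only if $K(BA-\lambda)$ is closed.
   Context: $\mathcal{L}(X,Y)$ is the set of bounded linear operators from $X$ to $Y$, and $\mathcal{L}(X)=\mathcal{L}(X,X)$. For $T\in\mathcal{L}(X)$, the analytic core $K(T)$ is the set of all $x\in X$ for which there exist a constant $c>0$ and a sequence $(x_n)_n\subset X$ such that $x_0=x$, $Tx_n=x_{n-1}$ and $\|x_n\|\leq c^n\|x\|$ for all $n\in\mathbb{N}$. *)

theory Defs
  imports "HOL-Analysis.Analysis"
begin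

text \<open>
  The library has only real normed spaces. A complex normed space is modelled as a real one
  with a complex scalar multiplication that extends the real one and for which the norm is
  homogeneous.
\<close>

class complex_vector = real_vector +
  fixes scaleC :: "complex \<Rightarrow> 'a \<Rightarrow> 'a" (infixr "*\<^sub>C" 75)
  assumes scaleC_add_right: "a *\<^sub>C (x + y) = a *\<^sub>C x + a *\<^sub>C y"
    and scaleC_add_left: "(a + b) *\<^sub>C x = a *\<^sub>C x + b *\<^sub>C x"
    and scaleC_scaleC: "a *\<^sub>C (b *\<^sub>C x) = (a * b) *\<^sub>C x"
    and scaleC_of_real: "complex_of_real r *\<^sub>C x = r *\<^sub>R x"

class complex_normed_vector = complex_vector + real_normed_vector +
  assumes norm_scaleC: "norm (a *\<^sub>C x) = cmod a * norm x"

class complex_banach = complex_normed_vector + banach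

instantiation complex :: complex_banach
begin

definition scaleC_complex :: "complex \<Rightarrow> complex \<Rightarrow> complex" where
  "scaleC_complex a x = a * x"

instance
  by standard (auto simp: scaleC_complex_def algebra_simps norm_mult scaleR_conv_of_real)

end

locale bounded_clinear = bounded_linear T
  for T :: "'a::complex_normed_vector \<Rightarrow> 'b::complex_normed_vector" +
  assumes scaleC: "T (a *\<^sub>C x) = a *\<^sub>C T x"

definition analytic_core :: "('a::complex_normed_vector \<Rightarrow> 'a) \<Rightarrow> 'a set" where
  "analytic_core T =
    {x. \<exists>c>0. \<exists>u :: nat \<Rightarrow> 'a.
      u 0 = x \<and> (\<forall>n. T (u (Suc n)) = u n) \<and> (\<forall>n. norm (u n) \<le> c ^ n * norm x)}"

end

theory Submission
  imports Defs
begin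

text \<open>
  Put \<open>S = AC\<close> and \<open>R = BA\<close>. The hypothesis provides intertwiners between \<open>S\<close> and \<open>R\<close> in
  both directions that compose to powers: the operators \<open>M = BACAC\<close> and \<open>N = ABA\<close> satisfy
  \<open>RM = MS\<close>, \<open>SN = NR\<close>, \<open>MN = R\<^sup>4\<close> and \<open>NM = S\<^sup>4\<close>. These four relations are symmetric in
  \<open>S\<close> and \<open>R\<close>, and they imply the theorem.

  Since \<open>N\<close> intertwines \<open>R - \<lambda>\<close> and \<open>S - \<lambda>\<close>, it carries \<open>K(R - \<lambda>)\<close> into \<open>K(S - \<lambda>)\<close>
  (\<open>analytic_core_intertwine\<close>), and \<open>M\<close> goes the other way. Conversely, if \<open>N x\<close> lies in
  \<open>K(S - \<lambda>)\<close>, then \<open>R\<^sup>4 x = M (N x)\<close> lies in \<open>K(R - \<lambda>)\<close>. The polynomials \<open>z\<^sup>4\<close> and \<open>z - \<lambda>\<close> are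
  coprime because \<open>\<lambda> \<noteq> 0\<close>, and this lets one cancel \<open>R\<^sup>4\<close> and conclude that \<open>x\<close> itself lies in
  \<open>K(R - \<lambda>)\<close> (\<open>analytic_core_cancel\<close>). Therefore \<open>K(R - \<lambda>)\<close> is the preimage of
  \<open>K(S - \<lambda>)\<close> under the continuous map \<open>N\<close>, and is closed whenever \<open>K(S - \<lambda>)\<close> is. The same
  argument with \<open>M\<close> in place of \<open>N\<close> gives the other implication.
\<close>

lemma additive_scaleC: "Modules.additive (scaleC a :: 'a::complex_vector \<Rightarrow> 'a)"
  by standard (rule scaleC_add_right)

lemma scaleC_one: "1 *\<^sub>C x = (x :: 'a::complex_vector)"
  using scaleC_of_real[of 1 x] by simp

lemma bounded_clinear_compose:
  assumes "bounded_clinear f" "bounded_clinear g"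
  shows "bounded_clinear (f \<circ> g)"
proof -
  interpret f: bounded_clinear f by fact
  interpret g: bounded_clinear g by fact
  have "bounded_linear (f \<circ> g)"
    using bounded_linear_compose[OF f.bounded_linear_axioms g.bounded_linear_axioms]
    by (simp add: comp_def)
  then show ?thesis
    by (simp add: bounded_clinear_def bounded_clinear_axioms_def f.scaleC g.scaleC)
qed

text \<open>
  In the definition of the analytic core the growth of the backward orbit is measured against
  the norm of its starting point. That is awkward under linear maps, which can shrink this norm.
  An arbitrary factor \<open>D\<close> is harmless: it only matters from the first step on, where it can be
  absorbed into a larger rate \<open>c\<close>; when the starting point is zero, the zero orbit serves.
\<close>

lemma analytic_coreI:
  fixes T :: "'a::complex_normed_vector \<Rightarrow> 'a"
  assumes "T 0 = 0" and "c > 0" and "\<And>n. T (u (Suc n)) = u n"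
    and bound: "\<And>n. norm (u n) \<le> D * c ^ n"
  shows "u 0 \<in> analytic_core T"
proof (cases "u 0 = 0")
  case True
  then show ?thesis
    using \<open>T 0 = 0\<close> unfolding analytic_core_def
    by (auto intro!: exI[of _ 1] exI[of _ "\<lambda>_. 0"])
next
  case False
  define r where "r = D / norm (u 0)"
  have "D \<ge> 0" using order_trans[OF norm_ge_zero bound[of 0]] by simp
  then have "r \<ge> 0" by (simp add: r_def)
  have "norm (u n) \<le> (c * (1 + r)) ^ n * norm (u 0)" for n
  proof (cases n)
    case (Suc m)
    have "r \<le> (1 + r) ^ 1" by simp
    also have "\<dots> \<le> (1 + r) ^ n"
      by (rule power_increasing) (use Suc \<open>r \<ge> 0\<close> in auto)
    finally have "D \<le> (1 + r) ^ n * norm (u 0)"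
      using False by (simp add: r_def divide_simps)
    then have "D * c ^ n \<le> ((1 + r) ^ n * norm (u 0)) * c ^ n"
      using \<open>c > 0\<close> by (intro mult_right_mono) auto
    then show ?thesis
      using bound[of n] by (simp add: power_mult_distrib mult_ac)
  qed simp
  then show ?thesis
    using assms(2,3) \<open>r \<ge> 0\<close> unfolding analytic_core_def
    by (auto intro!: exI[of _ "c * (1 + r)"] exI[of _ u])
qed

lemma analytic_coreE:
  assumes "x \<in> analytic_core T"
  obtains c u where "c > 0" "u 0 = x" "\<And>n. T (u (Suc n)) = u n"
    "\<And>n. norm (u n) \<le> norm x * c ^ n"
  using assms unfolding analytic_core_def by (auto simp: mult.commute)

lemma analytic_core_intertwine:
  assumes "bounded_linear M" and "\<And>y. U (M y) = M (T y)" and "U 0 = 0"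
    and "y \<in> analytic_core T"
  shows "M y \<in> analytic_core U"
proof -
  interpret M: bounded_linear M by fact
  obtain c u where u: "c > 0" "u 0 = y" "\<And>n. T (u (Suc n)) = u n"
    "\<And>n. norm (u n) \<le> norm y * c ^ n"
    using \<open>y \<in> analytic_core T\<close> by (rule analytic_coreE) blast
  obtain b where b: "b \<ge> 0" "\<And>z. norm (M z) \<le> norm z * b"
    using M.nonneg_bounded by blast
  have "norm (M (u n)) \<le> (norm y * b) * c ^ n" for n
    using b(2)[of "u n"] mult_right_mono[OF u(4)[of n] b(1)] by (simp add: mult_ac)
  then have "M (u 0) \<in> analytic_core U"
    using u(1,3) assms(2,3) by (intro analytic_coreI[where u = "\<lambda>n. M (u n)"]) auto
  then show ?thesis by (simp add: u(2))
qed

text \<open>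
  With \<open>U = R - \<lambda>\<close> one has \<open>\<lambda> y = R y - U y\<close>. If \<open>R y = u\<^sub>0 = U u\<^sub>1\<close>, this exhibits a
  preimage \<open>y\<^sub>1 = (u\<^sub>1 - y) / \<lambda>\<close> of \<open>y\<close> under \<open>U\<close>. It satisfies \<open>R y\<^sub>1 = u\<^sub>1\<close>, and so the
  construction can be repeated along the backward orbit of \<open>R y\<close>.
\<close>

lemma analytic_core_cancel:
  fixes R :: "'a::complex_normed_vector \<Rightarrow> 'a"
  assumes "bounded_clinear R" and "l \<noteq> 0"
    and "R y \<in> analytic_core (\<lambda>x. R x - l *\<^sub>C x)"
  shows "y \<in> analytic_core (\<lambda>x. R x - l *\<^sub>C x)"
proof -
  interpret R: bounded_clinear R by fact
  obtain c u where u: "c > 0" "u 0 = R y" "\<And>n. R (u (Suc n)) - l *\<^sub>C u (Suc n) = u n"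
    "\<And>n. norm (u n) \<le> norm (R y) * c ^ n"
    using assms(3) by (rule analytic_coreE) blast
  define v where "v = rec_nat y (\<lambda>n z. inverse l *\<^sub>C (u (Suc n) - z))"
  have v0: "v 0 = y" and vSuc: "v (Suc n) = inverse l *\<^sub>C (u (Suc n) - v n)" for n
    by (simp_all add: v_def)
  have l_vSuc: "l *\<^sub>C v (Suc n) = u (Suc n) - v n" for n
    using \<open>l \<noteq> 0\<close> by (simp add: vSuc scaleC_scaleC scaleC_one)
  have Rv: "R (v n) = u n" for n
  proof (induction n)
    case 0
    then show ?case by (simp add: v0 u(2))
  next
    case (Suc n)
    have "R (v (Suc n)) = inverse l *\<^sub>C (R (u (Suc n)) - u n)"
      by (simp add: vSuc R.scaleC R.diff Suc)
    also have "R (u (Suc n)) - u n = l *\<^sub>C u (Suc n)"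
      using u(3)[of n] by (simp add: algebra_simps)
    finally show ?case
      using \<open>l \<noteq> 0\<close> by (simp add: scaleC_scaleC scaleC_one)
  qed
  \<comment> \<open>The rate \<open>d\<close> dominates \<open>c\<close> and satisfies \<open>c + 1 \<le> |\<lambda>| d\<close>, as the recursion for \<open>v\<close> needs.\<close>
  define d where "d = c + (c + 1) / cmod l"
  define E where "E = norm (R y) + norm y"
  have d: "d > 0" "c \<le> d" "c + 1 \<le> cmod l * d"
    using \<open>c > 0\<close> \<open>l \<noteq> 0\<close> by (simp_all add: d_def add_pos_pos distrib_left add_divide_distrib)
  have "norm (v n) \<le> E * d ^ n" for n
  proof (induction n)
    case 0
    then show ?case by (simp add: v0 E_def)
  next
    case (Suc n)
    have "norm (u (Suc n)) \<le> E * (d ^ n * c)"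
    proof -
      have "norm (R y) * (c ^ n * c) \<le> E * (d ^ n * c)"
        using \<open>c > 0\<close> d by (intro mult_mono power_mono) (auto simp: E_def)
      then show ?thesis using u(4)[of "Suc n"] by (simp add: mult_ac)
    qed
    then have "cmod l * norm (v (Suc n)) \<le> E * (d ^ n * c) + E * d ^ n"
      using Suc norm_triangle_ineq4[of "u (Suc n)" "v n"]
      unfolding norm_scaleC[symmetric] l_vSuc by linarith
    also have "\<dots> = (E * d ^ n) * (c + 1)" by (simp add: algebra_simps)
    also have "\<dots> \<le> (E * d ^ n) * (cmod l * d)"
      using d by (intro mult_left_mono) (auto simp: E_def)
    also have "\<dots> = cmod l * (E * d ^ Suc n)" by (simp add: mult_ac)
    finally show ?case using \<open>l \<noteq> 0\<close> by simp
  qed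
  then have "v 0 \<in> analytic_core (\<lambda>x. R x - l *\<^sub>C x)"
    using d(1) by (intro analytic_coreI)
      (auto simp: Rv l_vSuc R.zero Modules.additive.zero[OF additive_scaleC])
  then show ?thesis by (simp add: v0)
qed

lemma analytic_core_cancel_funpow:
  fixes R :: "'a::complex_normed_vector \<Rightarrow> 'a"
  assumes "bounded_clinear R" and "l \<noteq> 0"
    and "(R ^^ k) y \<in> analytic_core (\<lambda>x. R x - l *\<^sub>C x)"
  shows "y \<in> analytic_core (\<lambda>x. R x - l *\<^sub>C x)"
  using assms(3) by (induction k) (auto intro: analytic_core_cancel[OF assms(1,2)])

lemma analytic_core_vimage:
  assumes R: "bounded_clinear R" and S: "bounded_clinear S"
    and M: "bounded_clinear M" and N: "bounded_clinear N"
    and NR: "\<And>x. N (R x) = S (N x)" and RM: "\<And>y. R (M y) = M (S y)"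
    and MN: "\<And>x. M (N x) = (R ^^ k) x" and "l \<noteq> 0"
  shows "analytic_core (\<lambda>x. R x - l *\<^sub>C x) = N -` analytic_core (\<lambda>y. S y - l *\<^sub>C y)"
    (is "?KR = N -` ?KS")
proof -
  interpret R: bounded_clinear R by fact
  interpret S: bounded_clinear S by fact
  interpret M: bounded_clinear M by fact
  interpret N: bounded_clinear N by fact
  note scaleC_0 = Modules.additive.zero[OF additive_scaleC]
  have "N x \<in> ?KS" if "x \<in> ?KR" for x
    by (rule analytic_core_intertwine[OF N.bounded_linear_axioms _ _ that])
      (simp_all add: N.diff N.scaleC NR S.zero scaleC_0)
  moreover have "x \<in> ?KR" if "N x \<in> ?KS" for x
  proof -
    have "M (N x) \<in> ?KR"
      by (rule analytic_core_intertwine[OF M.bounded_linear_axioms _ _ that])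
        (simp_all add: M.diff M.scaleC RM R.zero scaleC_0)
    then show ?thesis
      unfolding MN by (rule analytic_core_cancel_funpow[OF R \<open>l \<noteq> 0\<close>])
  qed
  ultimately show ?thesis by blast
qed

theorem theorem3p6:
  fixes A :: "'x::complex_banach \<Rightarrow> 'y::complex_banach"
    and B C :: "'y \<Rightarrow> 'x"
    and l :: complex
  assumes "bounded_clinear A" and "bounded_clinear B" and "bounded_clinear C"
    and "A \<circ> (B \<circ> A) ^^ 2 = A \<circ> B \<circ> A \<circ> C \<circ> A"
    and "A \<circ> B \<circ> A \<circ> C \<circ> A = A \<circ> C \<circ> A \<circ> B \<circ> A"
    and "A \<circ> C \<circ> A \<circ> B \<circ> A = (A \<circ> C) ^^ 2 \<circ> A"
    and "l \<noteq> 0"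
  shows "closed (analytic_core (\<lambda>y. (A \<circ> C) y - l *\<^sub>C y)) \<longleftrightarrow>
         closed (analytic_core (\<lambda>x. (B \<circ> A) x - l *\<^sub>C x))"
proof -
  \<comment> \<open>The hypothesis becomes three rewrite rules with the common normal form \<open>ACACA\<close>.\<close>
  have acaba: "A (C (A (B (A x)))) = A (C (A (C (A x))))" for x
    using fun_cong[OF assms(6), of x] by (simp add: numeral_2_eq_2)
  have abaca: "A (B (A (C (A x)))) = A (C (A (C (A x))))" for x
    using fun_cong[OF assms(5), of x] by (simp add: acaba)
  have ababa: "A (B (A (B (A x)))) = A (C (A (C (A x))))" for x
    using fun_cong[OF assms(4), of x] by (simp add: numeral_2_eq_2 abaca)
  define S where "S = A \<circ> C"
  define R where "R = B \<circ> A"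
  define M where "M = B \<circ> S \<circ> S"
  define N where "N = A \<circ> R"
  note defs = S_def R_def M_def N_def
  have cl: "bounded_clinear S" "bounded_clinear R" "bounded_clinear M" "bounded_clinear N"
    using assms(1-3) by (auto simp: defs intro!: bounded_clinear_compose)
  have NR: "N (R x) = S (N x)" for x
    by (simp add: defs acaba ababa)
  have RM: "R (M y) = M (S y)" for y
    by (simp add: defs abaca)
  have MN: "M (N x) = (R ^^ 4) x" for x
    by (simp add: defs eval_nat_numeral acaba ababa abaca)
  have NM: "N (M y) = (S ^^ 4) y" for y
    by (simp add: defs eval_nat_numeral ababa abaca)
  have KR: "analytic_core (\<lambda>x. R x - l *\<^sub>C x) = N -` analytic_core (\<lambda>y. S y - l *\<^sub>C y)"
    using analytic_core_vimage[OF cl(2,1,3,4) NR RM MN \<open>l \<noteq> 0\<close>] .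
  have KS: "analytic_core (\<lambda>y. S y - l *\<^sub>C y) = M -` analytic_core (\<lambda>x. R x - l *\<^sub>C x)"
    using analytic_core_vimage[OF cl(1,2,4,3) RM[symmetric] NR[symmetric] NM \<open>l \<noteq> 0\<close>] .
  have "continuous_on UNIV M" "continuous_on UNIV N"
    using cl(3,4) by (auto simp: bounded_clinear_def intro: linear_continuous_on)
  then show ?thesis
    unfolding S_def[symmetric] R_def[symmetric]
    using closed_vimage[of _ M] closed_vimage[of _ N] KR KS by metis
qed

end
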